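(* For every $\epsilon>0$ let $N=N(\epsilon)=10^{20}\epsilon^{-16\epsilon^{-1}}$. Let $n\geq N$ be an integer and let $G$ be a bipartite graph which is the union of $n$ pairwise edge-disjoint matchings $M_1,\dots,M_n$, each with at least $(1+\epsilon)n$ edges. Then $G$ contains a rainbow matching with $n$ edges.
   Context: The matchings $M_1,\dots,M_n$ are regarded as colour classes: each edge of $G$ lies in exactly one $M_i$ and receives colour $i$. A matching in $G$ is rainbow if no two of its edges have the same colour, i.e. it contains at most one edge from each $M_i$ (so a rainbow matching with $n$ edges contains exactly one edge of each $M_i$). *)

theory Defs
  imports Main "HOL-Analysis.Analysis"
begin

definition is_edge :: "'a set \<Rightarrow> bool" where
  "is_edge e \<longleftrightarrow> card e = 2"

definition matching :: "'a set set \<Rightarrow> bool" where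
  "matching M \<longleftrightarrow> (\<forall>e\<in>M. is_edge e) \<and>
     (\<forall>e\<in>M. \<forall>f\<in>M. e \<noteq> f \<longrightarrow> e \<inter> f = {})"

definition bipartite :: "'a set set \<Rightarrow> bool" where
  "bipartite E \<longleftrightarrow> (\<exists>X. \<forall>e\<in>E. is_edge e \<and> card (e \<inter> X) = 1)"

definition rainbow_matching :: "(nat \<Rightarrow> 'a set set) \<Rightarrow> nat \<Rightarrow> 'a set set \<Rightarrow> bool" where
  "rainbow_matching M n R \<longleftrightarrow> R \<subseteq> (\<Union>i<n. M i) \<and> matching R \<and>
     (\<forall>i<n. card (R \<inter> M i) \<le> 1)"

end

theory Submission
  imports Defs
begin

text \<open>View the coloured edges as triples (colour, left end, right end); a rainbow matching is then
  a matching of a linear 3-partite triple system. For \<open>\<epsilon> \<ge> 1\<close> the greedy algorithm works.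

  For \<open>\<epsilon> < 1\<close>, a random choice reserves vertex sets \<open>X\<close> and \<open>Y\<close> on the two sides such that every
  colour loses at most \<open>\<epsilon> n / 2\<close> edges to the reserve, but keeps linearly many edges between \<open>X\<close>
  and \<open>Y\<close>. A maximum rainbow matching \<open>R\<close> outside the reserve misses only a bounded number
  (depending on \<open>\<epsilon>\<close>) of colours, and these are completed greedily inside the reserve.

  The bound on the missing colours comes from iterated switching. Suppose a set \<open>A\<close> of edges of
  \<open>R\<close> can be freed (colour and left end) in a robust way. No edge whose colour and left end
  are both free or freeable ends outside \<open>R\<close> on the right, since it would augment \<open>R\<close>; so each free
  or freeable colour has at least \<open>\<epsilon> n / 2 + |A|\<close> such edges ending on the right in \<open>R\<close>. If \<open>q\<close>
  colours are missing, double counting shows that all but \<open>K n / q\<close> of the corresponding right ends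
  receive at least \<open>K\<close> such edges, and the edges of \<open>R\<close> there are robustly freeable as well. Hence
  \<open>A\<close> grows by \<open>\<epsilon> n / 4\<close> each time, which is impossible after \<open>4 / \<epsilon>\<close> rounds. Freeing an
  edge costs two edges of the previous level, so \<open>K\<close> of order \<open>2 ^ (4 / \<epsilon>)\<close> suffices.\<close>

section \<open>Linear tripartite triple systems\<close>

abbreviation col :: "'c \<times> 'x \<times> 'y \<Rightarrow> 'c" where "col \<equiv> fst"
abbreviation lft :: "'c \<times> 'x \<times> 'y \<Rightarrow> 'x" where "lft h \<equiv> fst (snd h)"
abbreviation rgt :: "'c \<times> 'x \<times> 'y \<Rightarrow> 'y" where "rgt h \<equiv> snd (snd h)"

definition matching3 :: "('c \<times> 'x \<times> 'y) set \<Rightarrow> bool" where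
  "matching3 R \<longleftrightarrow> inj_on col R \<and> inj_on lft R \<and> inj_on rgt R"

text \<open>The first two cases say that each colour class is a matching, the third that distinct
  classes share no edge.\<close>

definition linear3 :: "('c \<times> 'x \<times> 'y) set \<Rightarrow> bool" where
  "linear3 H \<longleftrightarrow> (\<forall>g\<in>H. \<forall>h\<in>H.
     (col g = col h \<and> lft g = lft h) \<or> (col g = col h \<and> rgt g = rgt h) \<or>
     (lft g = lft h \<and> rgt g = rgt h) \<longrightarrow> g = h)"

lemma linear3_subset: "linear3 H \<Longrightarrow> G \<subseteq> H \<Longrightarrow> linear3 G"
  unfolding linear3_def by blast

lemma linear3D:
  assumes "linear3 H" "g \<in> H" "h \<in> H"
  shows "col g = col h \<Longrightarrow> lft g = lft h \<Longrightarrow> g = h"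
    and "col g = col h \<Longrightarrow> rgt g = rgt h \<Longrightarrow> g = h"
    and "lft g = lft h \<Longrightarrow> rgt g = rgt h \<Longrightarrow> g = h"
  using assms unfolding linear3_def by blast+

lemma linear3_inj_on_rgt:
  assumes "linear3 H" "A \<subseteq> H" "\<And>h. h \<in> A \<Longrightarrow> rgt h = y"
  shows "inj_on col A" "inj_on lft A"
  by (rule inj_onI, rule linear3D(2)[OF assms(1)]; simp add: assms(3) subsetD[OF assms(2)])
    (rule inj_onI, rule linear3D(3)[OF assms(1)]; simp add: assms(3) subsetD[OF assms(2)])

lemma linear3_inj_on_col:
  assumes "linear3 H" "A \<subseteq> H" "\<And>h. h \<in> A \<Longrightarrow> col h = c"
  shows "inj_on lft A" "inj_on rgt A"
  by (rule inj_onI, rule linear3D(1)[OF assms(1)]; simp add: assms(3) subsetD[OF assms(2)])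
    (rule inj_onI, rule linear3D(2)[OF assms(1)]; simp add: assms(3) subsetD[OF assms(2)])

lemma matching3D:
  assumes "matching3 R" "g \<in> R" "h \<in> R"
  shows "col g = col h \<Longrightarrow> g = h" "lft g = lft h \<Longrightarrow> g = h" "rgt g = rgt h \<Longrightarrow> g = h"
  using assms unfolding matching3_def by (auto dest: inj_onD)

lemma matching3_insert:
  assumes "matching3 R" "col h \<notin> col ` R" "lft h \<notin> lft ` R" "rgt h \<notin> rgt ` R"
  shows "matching3 (insert h R)"
  using assms unfolding matching3_def by (auto simp: inj_on_insert)

lemma matching3_subset: "matching3 R \<Longrightarrow> S \<subseteq> R \<Longrightarrow> matching3 S"
  unfolding matching3_def by (meson inj_on_subset)

lemma matching3_union:
  assumes "matching3 R" "matching3 S" "col ` R \<inter> col ` S = {}" "lft ` R \<inter> lft ` S = {}"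
    "rgt ` R \<inter> rgt ` S = {}"
  shows "matching3 (R \<union> S)"
  using assms unfolding matching3_def by (auto simp: inj_on_Un)

lemma card_less_not_subset: "finite A \<Longrightarrow> card A < card B \<Longrightarrow> \<not> B \<subseteq> A"
  by (meson card_mono leD)

lemma card_Un4_le: "card (A \<union> B \<union> C \<union> D) \<le> card A + card B + card C + card D"
  using card_Un_le[of "A \<union> B \<union> C" D] card_Un_le[of "A \<union> B" C] card_Un_le[of A B] by linarith

text \<open>Each triple already chosen excludes at most one triple of the current colour through its
  left end and one through its right end, so fewer than \<open>2 * N\<close> are excluded while a
  colour is still to be served.\<close>

lemma greedy_matching3:
  assumes "finite L" "finite G" "linear3 G" "card L \<le> N"
    "\<And>c. c \<in> L \<Longrightarrow> 2 * N \<le> card {h \<in> G. col h = c}"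
  shows "\<exists>S \<subseteq> G. matching3 S \<and> col ` S = L"
  using assms(1,4,5)
proof (induction L rule: finite_induct)
  case empty
  show ?case by (intro exI[of _ "{}"]) (auto simp: matching3_def)
next
  case (insert c L)
  then obtain S where S: "S \<subseteq> G" "matching3 S" "col ` S = L"
    by force
  have finS: "finite S" using S(1) assms(2) finite_subset by blast
  have cardS: "card S = card L"
    using S card_image[of col S] by (simp add: matching3_def)
  let ?F = "{h \<in> G. col h = c}"
  let ?B1 = "{h \<in> ?F. lft h \<in> lft ` S}" and ?B2 = "{h \<in> ?F. rgt h \<in> rgt ` S}"
  have finF: "finite ?F" using assms(2) by simp
  have "inj_on lft ?B1" "inj_on rgt ?B2"
    by (rule linear3_inj_on_col[OF assms(3), where c = c]; auto)+
  then have "card ?B1 = card (lft ` ?B1)" "card ?B2 = card (rgt ` ?B2)"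
    by (simp_all only: card_image)
  moreover have "card (lft ` ?B1) \<le> card (lft ` S)" "card (rgt ` ?B2) \<le> card (rgt ` S)"
    by (intro card_mono; use finS in auto)+
  moreover have "card (lft ` S) \<le> card S" "card (rgt ` S) \<le> card S"
    using finS by (simp_all add: card_image_le)
  moreover have "card (?B1 \<union> ?B2) \<le> card ?B1 + card ?B2"
    by (rule card_Un_le)
  ultimately have "card (?B1 \<union> ?B2) \<le> 2 * card L"
    using cardS by linarith
  also have "\<dots> < card ?F"
    using insert.prems(1) insert.prems(2)[of c] insert.hyps by auto
  finally have "\<not> ?F \<subseteq> ?B1 \<union> ?B2"
    using card_less_not_subset[of "?B1 \<union> ?B2" ?F] assms(2) by simp
  then obtain h where h: "h \<in> G" "col h = c" "lft h \<notin> lft ` S" "rgt h \<notin> rgt ` S"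
    by blast
  have "matching3 (insert h S)"
    using h S insert.hyps by (intro matching3_insert) auto
  then show ?case
    using h S by (intro exI[of _ "insert h S"]) auto
qed

section \<open>Switching\<close>

locale switching =
  fixes H R :: "('c \<times> 'x \<times> 'y) set" and K :: nat
  assumes finH: "finite H" and lin: "linear3 H" and RH: "R \<subseteq> H" and matR: "matching3 R"
begin

definition swaps :: "('c \<times> 'x \<times> 'y) set \<Rightarrow> 'y \<Rightarrow> ('c \<times> 'x \<times> 'y) set" where
  "swaps A y = {h \<in> H. rgt h = y \<and> col h \<notin> col ` (R - A) \<and> lft h \<notin> lft ` (R - A)}"

text \<open>A triple in \<open>level t\<close> can be switched out of \<open>R\<close> in many almost disjoint ways, each
  step using a colour and a left vertex that are free or were made free at a lower level.\<close>

primrec level :: "nat \<Rightarrow> ('c \<times> 'x \<times> 'y) set" where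
  "level 0 = {}"
| "level (Suc t) = {u \<in> R. K \<le> card (swaps (level t) (rgt u))}"

text \<open>Switching changes colours and left ends but keeps the set of right ends. Hence the size
  stays that of \<open>R\<close>, and a right end missed by \<open>R\<close> is missed by every
  variant.\<close>

definition variant :: "('c \<times> 'x \<times> 'y) set \<Rightarrow> bool" where
  "variant S \<longleftrightarrow> S \<subseteq> H \<and> matching3 S \<and> rgt ` S = rgt ` R"

text \<open>\<open>P\<close> and \<open>Q\<close> are the protected colours and left ends: they lock
  triples that must be kept, and colours or left ends that have already been freed.\<close>

definition agree :: "'c set \<Rightarrow> 'x set \<Rightarrow> ('c \<times> 'x \<times> 'y) set \<Rightarrow> ('c \<times> 'x \<times> 'y) set \<Rightarrow> bool" where
  "agree P Q S S' \<longleftrightarrow> (\<forall>r. col r \<in> P \<or> lft r \<in> Q \<longrightarrow> (r \<in> S \<longleftrightarrow> r \<in> S'))"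

text \<open>Freeing a triple of level \<open>t\<close> creates at most \<open>2 ^ t - 1\<close> new
  deviations from \<open>R\<close>, the solution of c' = 2c + 1 starting from 0. The hypothesis
  involving \<open>K\<close> accounts for the choices spoilt by earlier changes and protections; its
  last term leaves room for the recursive switches.\<close>

definition freeable :: "nat \<Rightarrow> bool" where
  "freeable t \<longleftrightarrow> (\<forall>S P Q u. variant S \<longrightarrow> u \<in> level t \<longrightarrow> u \<in> S \<longrightarrow> finite P \<longrightarrow> finite Q \<longrightarrow>
     col u \<notin> P \<longrightarrow> lft u \<notin> Q \<longrightarrow> 4 * card (R - S) + 2 * (card P + card Q) + 6 * 2 ^ t \<le> K \<longrightarrow>
     (\<exists>S'. variant S' \<and> agree P Q S S' \<and> col u \<notin> col ` S' \<and> lft u \<notin> lft ` S' \<and>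
        card (R - S') + 1 \<le> card (R - S) + 2 ^ t))"

lemma finR: "finite R"
  using finH RH finite_subset by blast

lemma level_subset: "level t \<subseteq> R"
  by (cases t) auto

lemma variant_self: "variant R"
  using RH matR by (simp add: variant_def)

lemma finite_variant: "variant S \<Longrightarrow> finite S"
  using finH finite_subset unfolding variant_def by blast

lemma card_variant_diff:
  assumes "variant S"
  shows "card (S - R) = card (R - S)"
proof -
  have "card S = card R"
    using assms matR card_image[of rgt S] card_image[of rgt R]
    by (simp add: variant_def matching3_def)
  then show ?thesis
    using finite_variant[OF assms] finR card_Diff_subset_Int[of S R] card_Diff_subset_Int[of R S]
    by (simp add: Int_commute)
qed

lemma agree_mono: "agree P Q S S' \<Longrightarrow> P' \<subseteq> P \<Longrightarrow> Q' \<subseteq> Q \<Longrightarrow> agree P' Q' S S'"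
  unfolding agree_def by blast

lemma agree_trans: "agree P Q S S' \<Longrightarrow> agree P Q S' S'' \<Longrightarrow> agree P Q S S''"
  unfolding agree_def by blast

lemma agree_refl: "agree P Q S S"
  unfolding agree_def by blast

text \<open>If one triple of \<open>R\<close> carries both \<open>i\<close> and \<open>x\<close>,
  freeing it suffices. Otherwise the two triples are freed in turn, with \<open>x\<close> protected
  during the first switch and \<open>i\<close> during the second. The conditions \<open>iQ\<close>
  and \<open>xP\<close> keep these triples from being locked by the given protections.\<close>

lemma free_pair:
  assumes fr: "freeable t" and S: "variant S" and fin: "finite P" "finite Q"
    and i: "i \<notin> col ` (R - level t)" "i \<notin> P" "i \<notin> col ` (R - S)" "i \<notin> col ` (S - R)"
    and x: "x \<notin> lft ` (R - level t)" "x \<notin> Q" "x \<notin> lft ` (R - S)" "x \<notin> lft ` (S - R)"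
    and iQ: "\<And>u. u \<in> R \<Longrightarrow> col u = i \<Longrightarrow> lft u \<notin> Q"
    and xP: "\<And>u. u \<in> R \<Longrightarrow> lft u = x \<Longrightarrow> col u \<notin> P"
    and bud: "4 * card (R - S) + 2 * (card P + card Q) + 10 * 2 ^ t \<le> K + 2"
  shows "\<exists>S'. variant S' \<and> agree P Q S S' \<and> i \<notin> col ` S' \<and> x \<notin> lft ` S' \<and>
    card (R - S') + 2 \<le> card (R - S) + 2 * 2 ^ t"
proof -
  have pos: "(1::nat) \<le> 2 ^ t" by simp
  have bud0: "4 * card (R - S) + 2 * (card P + card Q) + 6 * 2 ^ t + 2 \<le> K"
    using bud pos by linarith
  note free = fr[unfolded freeable_def, rule_format]
  show ?thesis
  proof (cases "\<exists>u \<in> R. col u = i \<and> lft u = x")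
    case True
    then obtain u where u: "u \<in> R" "col u = i" "lft u = x" by blast
    have "u \<in> level t" "u \<in> S" using u i by blast+
    then obtain S' where "variant S'" "agree P Q S S'" "col u \<notin> col ` S'" "lft u \<notin> lft ` S'"
      "card (R - S') + 1 \<le> card (R - S) + 2 ^ t"
      using free[of S u P Q] S fin u(2,3) i(2) x(2) bud0 by auto
    moreover have "card (R - S') + 2 \<le> card (R - S) + 2 * 2 ^ t"
      using calculation(5) pos by linarith
    ultimately show ?thesis using u by blast
  next
    case False
    have "\<exists>S1. variant S1 \<and> agree P (insert x Q) S S1 \<and> i \<notin> col ` S1 \<and>
      card (R - S1) + 1 \<le> card (R - S) + 2 ^ t"
    proof (cases "i \<in> col ` R")
      case True
      then obtain u where u: "u \<in> R" "col u = i" by blast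
      have "u \<in> level t" "u \<in> S" using u i by blast+
      moreover have "lft u \<notin> insert x Q" using u False iQ by blast
      moreover have "card (insert x Q) \<le> card Q + 1"
        by (simp add: card_insert_le_m1 fin(2) card_insert_if)
      ultimately show ?thesis
        using free[of S u P "insert x Q"] S fin u(2) i(2) bud0 by auto
    next
      case False
      then have "i \<notin> col ` S" using i by blast
      then show ?thesis using S pos agree_refl by (intro exI[of _ S]) auto
    qed
    then obtain S1 where S1: "variant S1" "agree P (insert x Q) S S1" "i \<notin> col ` S1"
      "card (R - S1) + 1 \<le> card (R - S) + 2 ^ t" by blast
    show ?thesis
    proof (cases "x \<in> lft ` R")
      case True
      then obtain u where u: "u \<in> R" "lft u = x" by blast
      have u': "u \<in> level t" "u \<in> S" using u x by blast+
      then have uS1: "u \<in> S1" using S1(2) u unfolding agree_def by blast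
      then have ui: "col u \<notin> insert i P" using S1(3) xP u by blast
      have "card (insert i P) \<le> card P + 1"
        by (simp add: fin(1) card_insert_if)
      \<comment> \<open>The first switch adds at most \<open>2 ^ t - 1\<close> deviations and
        \<open>i\<close> is one more protected colour:
        \<open>4 * (2 ^ t - 1) + 2 + 6 * 2 ^ t = 10 * 2 ^ t - 2\<close>, which explains the
        \<open>K + 2\<close> in \<open>bud\<close>.\<close>
      then have "4 * card (R - S1) + 2 * (card (insert i P) + card Q) + 6 * 2 ^ t \<le> K"
        using S1(4) bud by simp
      then obtain S2 where S2: "variant S2" "agree (insert i P) Q S1 S2" "lft u \<notin> lft ` S2"
        "card (R - S2) + 1 \<le> card (R - S1) + 2 ^ t"
        using free[of S1 u "insert i P" Q] S1(1) u'(1) uS1 fin ui u(2) x(2) by blast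
      have "i \<notin> col ` S2" using S2(2) S1(3) unfolding agree_def by blast
      moreover have "agree P Q S S2"
        using agree_trans[OF agree_mono[OF S1(2), of P Q] agree_mono[OF S2(2), of P Q]] by blast
      ultimately show ?thesis using S2 S1 u by (intro exI[of _ S2]) auto
    next
      case False
      then have "x \<notin> lft ` S" using x by blast
      then have "x \<notin> lft ` S1" using S1(2) unfolding agree_def by blast
      moreover have "agree P Q S S1" using agree_mono[OF S1(2)] by blast
      moreover have "card (R - S1) + 2 \<le> card (R - S) + 2 * 2 ^ t" using S1(4) pos by linarith
      ultimately show ?thesis using S1 by blast
    qed
  qed
qed

text \<open>Among the candidates sharing the right end of \<open>u\<close>, some \<open>w\<close>
  avoids everything deviating or protected. Freeing its colour and left end takes at most two
  switches of level \<open>t\<close>, and then \<open>w\<close> replaces \<open>u\<close>; the cost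
  is \<open>2 * (2 ^ t - 1) + 1 = 2 ^ (t + 1) - 1\<close>.\<close>

lemma freeable_step:
  assumes fr: "freeable t"
  shows "freeable (Suc t)"
  unfolding freeable_def
proof (intro allI impI)
  fix S P Q u
  assume S: "variant S" and u: "u \<in> level (Suc t)" and uS: "u \<in> S"
    and fin: "finite P" "finite Q" and uP: "col u \<notin> P" and uQ: "lft u \<notin> Q"
    and bud: "4 * card (R - S) + 2 * (card P + card Q) + 6 * 2 ^ Suc t \<le> K"
  have pos: "(1::nat) \<le> 2 ^ t" by simp
  have uR: "u \<in> R" and uK: "K \<le> card (swaps (level t) (rgt u))" using u by auto
  have finS: "finite S" using finite_variant S by blast
  let ?W = "swaps (level t) (rgt u)"
  \<comment> \<open>A colour is ruled out if it is protected or belongs to \<open>u\<close>, if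
    \<open>S\<close> and \<open>R\<close> differ there, or if the triple of \<open>R\<close> holding
    it has a protected left end and so cannot be moved. \<open>?Bx\<close> is symmetric.\<close>
  let ?Bc = "insert (col u) P \<union> col ` (R - S) \<union> col ` (S - R) \<union> col ` {v \<in> R. lft v \<in> Q}"
  let ?Bx = "insert (lft u) Q \<union> lft ` (R - S) \<union> lft ` (S - R) \<union> lft ` {v \<in> R. col v \<in> P}"
  have "inj_on lft {v \<in> R. lft v \<in> Q}" "inj_on col {v \<in> R. col v \<in> P}"
    using matR unfolding matching3_def inj_on_def by blast+
  moreover have "lft ` {v \<in> R. lft v \<in> Q} \<subseteq> Q" "col ` {v \<in> R. col v \<in> P} \<subseteq> P" by auto
  ultimately have "card {v \<in> R. lft v \<in> Q} \<le> card Q" "card {v \<in> R. col v \<in> P} \<le> card P"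
    using fin by (meson card_inj_on_le)+
  then have c4: "card (col ` {v \<in> R. lft v \<in> Q}) \<le> card Q" "card (lft ` {v \<in> R. col v \<in> P}) \<le> card P"
    using card_image_le[of "{v \<in> R. lft v \<in> Q}" col] card_image_le[of "{v \<in> R. col v \<in> P}" lft] finR
    by auto
  have c3: "card (col ` (S - R)) \<le> card (R - S)" "card (lft ` (S - R)) \<le> card (R - S)"
    "card (col ` (R - S)) \<le> card (R - S)" "card (lft ` (R - S)) \<le> card (R - S)"
    using card_image_le[of "S - R" col] card_image_le[of "S - R" lft] card_image_le[of "R - S" col]
      card_image_le[of "R - S" lft] finR finS card_variant_diff[OF S] by auto
  have c1: "card (insert (col u) P) \<le> card P + 1" "card (insert (lft u) Q) \<le> card Q + 1"
    using fin by (simp_all add: card_insert_if)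
  have Bc: "card ?Bc \<le> (card P + 1) + card (R - S) + card (R - S) + card Q"
    by (rule order.trans[OF card_Un4_le]) (intro add_mono c1 c3 c4)
  have Bx: "card ?Bx \<le> (card Q + 1) + card (R - S) + card (R - S) + card P"
    by (rule order.trans[OF card_Un4_le]) (intro add_mono c1 c3 c4)
  have "card ?Bc + card ?Bx \<le> 4 * card (R - S) + 2 * (card P + card Q) + 2"
    by (rule order.trans[OF add_mono[OF Bc Bx]]) simp
  also have "\<dots> < K" using bud pos by (simp only: power_Suc)
  finally have small: "card ?Bc + card ?Bx < K" .
  have finW: "finite ?W" using finH by (simp add: swaps_def)
  have finB: "finite ?Bc" "finite ?Bx" using fin finR finS by auto
  let ?W1 = "{h \<in> ?W. col h \<in> ?Bc}" and ?W2 = "{h \<in> ?W. lft h \<in> ?Bx}"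
  \<comment> \<open>All candidates share a right end, so by linearity each forbidden colour or left
    end eliminates at most one of them.\<close>
  have "inj_on col ?W1" "inj_on lft ?W2"
    by (rule linear3_inj_on_rgt[OF lin, where y = "rgt u"]; auto simp: swaps_def)+
  moreover have "col ` ?W1 \<subseteq> ?Bc" "lft ` ?W2 \<subseteq> ?Bx" by blast+
  ultimately have "card ?W1 \<le> card ?Bc" "card ?W2 \<le> card ?Bx"
    using finB by (meson card_inj_on_le)+
  then have "card (?W1 \<union> ?W2) < card ?W"
    using card_Un_le[of ?W1 ?W2] small uK by linarith
  then have "\<not> ?W \<subseteq> ?W1 \<union> ?W2"
    using card_less_not_subset[of "?W1 \<union> ?W2" ?W] finW by simp
  then obtain w where w: "w \<in> ?W" "col w \<notin> ?Bc" "lft w \<notin> ?Bx" by blast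
  have wH: "w \<in> H" "rgt w = rgt u" "col w \<notin> col ` (R - level t)" "lft w \<notin> lft ` (R - level t)"
    using w(1) by (auto simp: swaps_def)
  \<comment> \<open>Protecting \<open>u\<close> adds 4 to the budget, which fits because
    \<open>bud\<close> provides \<open>12 * 2 ^ t\<close> and \<open>2 ^ t \<ge> 1\<close>.\<close>
  have "4 * card (R - S) + 2 * (card (insert (col u) P) + card (insert (lft u) Q)) + 10 * 2 ^ t
      \<le> 4 * card (R - S) + 2 * ((card P + 1) + (card Q + 1)) + 10 * 2 ^ t"
    by (intro add_mono mult_left_mono c1) auto
  also have "\<dots> = (4 * card (R - S) + 2 * (card P + card Q)) + 4 + 10 * 2 ^ t" by simp
  also have "\<dots> \<le> K + 2"
  proof -
    have "a + 4 + 10 * x \<le> K + 2" if "a + 12 * x \<le> K" "1 \<le> x" for a x :: nat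
      using that by linarith
    from this[OF _ pos] show ?thesis by this (use bud in simp)
  qed
  finally have "4 * card (R - S) + 2 * (card (insert (col u) P) + card (insert (lft u) Q)) + 10 * 2 ^ t
      \<le> K + 2" .
  moreover have "lft v \<notin> insert (lft u) Q" if "v \<in> R" "col v = col w" for v
  proof -
    have "lft v \<noteq> lft u"
      using matching3D(2)[OF matR that(1) uR] that(2) w(2) by auto
    moreover have "lft v \<notin> Q"
    proof
      assume "lft v \<in> Q"
      then have "col v \<in> col ` {v \<in> R. lft v \<in> Q}" using that(1) by blast
      then show False using that(2) w(2) by simp
    qed
    ultimately show ?thesis by simp
  qed
  moreover have "col v \<notin> insert (col u) P" if "v \<in> R" "lft v = lft w" for v
  proof -
    have "col v \<noteq> col u"
      using matching3D(1)[OF matR that(1) uR] that(2) w(3) by auto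
    moreover have "col v \<notin> P"
    proof
      assume "col v \<in> P"
      then have "lft v \<in> lft ` {v \<in> R. col v \<in> P}" using that(1) by blast
      then show False using that(2) w(3) by simp
    qed
    ultimately show ?thesis by simp
  qed
  ultimately obtain S2 where S2: "variant S2" "agree (insert (col u) P) (insert (lft u) Q) S S2"
    "col w \<notin> col ` S2" "lft w \<notin> lft ` S2" "card (R - S2) + 2 \<le> card (R - S) + 2 * 2 ^ t"
    using free_pair[OF fr S, of "insert (col u) P" "insert (lft u) Q" "col w" "lft w"] fin w(2,3) wH(3,4)
    by auto
  have uS2: "u \<in> S2" using S2(2) uS unfolding agree_def by blast
  let ?S' = "insert w (S2 - {u})"
  have m2: "matching3 S2" and S2H: "S2 \<subseteq> H" and r2: "rgt ` S2 = rgt ` R"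
    using S2(1) by (auto simp: variant_def)
  have out: "col u \<notin> col ` (S2 - {u})" "lft u \<notin> lft ` (S2 - {u})" "rgt u \<notin> rgt ` (S2 - {u})"
    by (auto dest: matching3D[OF m2 _ uS2])
  have "matching3 ?S'"
    using matching3_subset[OF m2, of "S2 - {u}"] S2(3,4) out(3) wH(2)
    by (intro matching3_insert) auto
  moreover have "rgt ` ?S' = rgt ` S2"
    using uS2 wH(2) by (auto simp: image_iff intro: rev_bexI)
  ultimately have "variant ?S'" using S2H wH(1) r2 by (auto simp: variant_def)
  moreover have "agree P Q S ?S'"
    unfolding agree_def
  proof (intro allI impI)
    fix r :: "'c \<times> 'x \<times> 'y" assume r: "col r \<in> P \<or> lft r \<in> Q"
    have "r \<noteq> w" "r \<noteq> u" using r w uP uQ by auto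
    then show "r \<in> S \<longleftrightarrow> r \<in> ?S'" using r S2(2) unfolding agree_def by blast
  qed
  moreover have "col u \<notin> col ` ?S'" "lft u \<notin> lft ` ?S'" using out w(2,3) by auto
  moreover have "card (R - ?S') + 1 \<le> card (R - S) + 2 ^ Suc t"
  proof -
    have "card (R - ?S') \<le> card (insert u (R - S2))"
      using finR by (intro card_mono) auto
    also have "\<dots> \<le> card (R - S2) + 1" using finR by (simp add: card_insert_if)
    finally show ?thesis using S2(5) by simp
  qed
  ultimately show "\<exists>S'. variant S' \<and> agree P Q S S' \<and> col u \<notin> col ` S' \<and> lft u \<notin> lft ` S' \<and>
      card (R - S') + 1 \<le> card (R - S) + 2 ^ Suc t" by blast
qed

lemma freeable: "freeable t"
proof (induction t)
  case 0
  show ?case by (simp add: freeable_def)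
qed (rule freeable_step)

text \<open>Starting from \<open>R\<close> with nothing protected, the colour and left end of
  \<open>h\<close> are freed. The right end of \<open>h\<close> is missed by every variant, so
  \<open>h\<close> can then be added.\<close>

lemma augment:
  assumes "h \<in> H" "col h \<notin> col ` (R - level t)" "lft h \<notin> lft ` (R - level t)" "rgt h \<notin> rgt ` R"
    and "12 * 2 ^ t \<le> K"
  shows "\<exists>S \<subseteq> H. matching3 S \<and> card R < card S"
proof -
  obtain S where S: "variant S" "col h \<notin> col ` S" "lft h \<notin> lft ` S"
    using free_pair[OF freeable[of t] variant_self, of "{}" "{}" "col h" "lft h"] assms by auto
  then have "rgt h \<notin> rgt ` S" using assms(4) by (auto simp: variant_def)
  then have "matching3 (insert h S)" "h \<notin> S" using S by (auto simp: variant_def intro!: matching3_insert)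
  moreover have "card S = card R"
    using S(1) matR card_image[of rgt S] card_image[of rgt R]
    by (simp add: variant_def matching3_def)
  ultimately show ?thesis
    using S(1) assms(1) finite_variant[OF S(1)]
    by (intro exI[of _ "insert h S"]) (auto simp: variant_def)
qed

text \<open>Double counting of the triples whose colour and left end are both available at level
  \<open>t\<close>. By maximality their right ends are all covered by \<open>R\<close>. In each
  available colour at most \<open>card R - card (level t)\<close> triples have a blocked left end. A
  right end receives fewer than \<open>K\<close> of the counted triples unless its triple of
  \<open>R\<close> enters \<open>level (Suc t)\<close>, and then at most
  \<open>card Q\<close>.\<close>

lemma level_growth:
  assumes finC: "finite C" and HC: "col ` H \<subseteq> C"
    and deg: "\<And>c. c \<in> C \<Longrightarrow> D \<le> card {h \<in> H. col h = c}"
    and opt: "\<And>S. S \<subseteq> H \<Longrightarrow> matching3 S \<Longrightarrow> card S \<le> card R"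
    and K: "12 * 2 ^ t \<le> K"
  defines "Q \<equiv> C - col ` (R - level t)"
  shows "card Q * (D + card (level t)) \<le> card Q * (card (level (Suc t)) + card R) + card R * K"
proof -
  define W where "W = {h \<in> H. col h \<in> Q \<and> lft h \<notin> lft ` (R - level t)}"
  have finW: "finite W" and WH: "W \<subseteq> H" using finH by (auto simp: W_def)
  have finQ: "finite Q" using finC by (simp add: Q_def)
  have finL: "finite (level s)" for s using level_subset finR finite_subset by blast
  have WR: "rgt ` W \<subseteq> rgt ` R"
  proof (rule ccontr)
    assume "\<not> ?thesis"
    then obtain h where h: "h \<in> W" "rgt h \<notin> rgt ` R" by blast
    have "\<exists>S \<subseteq> H. matching3 S \<and> card R < card S"
      by (rule augment[of h t]) (use h K in \<open>auto simp: W_def Q_def\<close>)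
    then show False using opt by (meson leD)
  qed
  have low: "D + card (level t) \<le> card {h \<in> W. col h = c} + card R" if c: "c \<in> Q" for c
  proof -
    let ?B = "{h \<in> H. col h = c \<and> lft h \<in> lft ` (R - level t)}"
    have "inj_on lft ?B" by (rule linear3_inj_on_col[OF lin, where c = c]) auto
    moreover have "lft ` ?B \<subseteq> lft ` (R - level t)" by blast
    ultimately have "card ?B \<le> card (lft ` (R - level t))"
      using finR by (intro card_inj_on_le[of lft]) auto
    also have "\<dots> \<le> card (R - level t)" using finR by (simp add: card_image_le)
    also have "\<dots> = card R - card (level t)" using finL level_subset by (rule card_Diff_subset)
    finally have B: "card ?B \<le> card R - card (level t)" .
    have "{h \<in> H. col h = c} \<subseteq> {h \<in> W. col h = c} \<union> ?B" using c by (auto simp: W_def)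
    then have "card {h \<in> H. col h = c} \<le> card {h \<in> W. col h = c} + card ?B"
      using finW finH by (intro order.trans[OF card_mono card_Un_le]) auto
    moreover have "D \<le> card {h \<in> H. col h = c}" using c by (intro deg) (simp add: Q_def)
    moreover have "card (level t) \<le> card R" using finR level_subset by (rule card_mono)
    ultimately show ?thesis using B by linarith
  qed
  have "card Q * (D + card (level t)) = (\<Sum>c\<in>Q. D + card (level t))" by simp
  also have "\<dots> \<le> (\<Sum>c\<in>Q. card {h \<in> W. col h = c} + card R)"
    by (rule sum_mono) (rule low)
  also have "\<dots> = (\<Sum>c\<in>Q. card {h \<in> W. col h = c}) + card Q * card R"
    by (simp add: sum.distrib)
  also have "(\<Sum>c\<in>Q. card {h \<in> W. col h = c}) = card W"
    using sum.group[of W Q col "\<lambda>_. 1::nat"] finW finQ by (auto simp: W_def)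
  also have "card W = (\<Sum>y\<in>rgt ` R. card {h \<in> W. rgt h = y})"
    using sum.group[of W "rgt ` R" rgt "\<lambda>_. 1::nat"] finW finR WR by auto
  also have "\<dots> = (\<Sum>u\<in>R. card {h \<in> W. rgt h = rgt u})"
    using matR by (simp add: sum.reindex matching3_def)
  \<comment> \<open>Granting the extra \<open>K\<close> also to triples of the next level is a
    harmless overcount that lets the sum split.\<close>
  also have "\<dots> \<le> (\<Sum>u\<in>R. (if u \<in> level (Suc t) then card Q else 0) + K)"
  proof (rule sum_mono)
    fix u assume u: "u \<in> R"
    let ?F = "{h \<in> W. rgt h = rgt u}"
    have "?F \<subseteq> swaps (level t) (rgt u)" by (auto simp: W_def Q_def swaps_def)
    then have "card ?F \<le> card (swaps (level t) (rgt u))"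
      using finH by (intro card_mono) (auto simp: swaps_def)
    moreover have "inj_on col ?F"
      by (rule linear3_inj_on_rgt[OF lin, where y = "rgt u"]) (use WH in auto)
    then have "card ?F \<le> card Q"
      using finQ by (intro card_inj_on_le[of col]) (auto simp: W_def)
    ultimately show "card ?F \<le> (if u \<in> level (Suc t) then card Q else 0) + K"
      using u by auto
  qed
  also have "\<dots> = card (level (Suc t)) * card Q + card R * K"
    using finR level_subset[of "Suc t"]
    by (simp add: sum.distrib sum.If_cases Int_absorb1 del: level.simps)
  finally show ?thesis by (simp add: algebra_simps del: level.simps)
qed

text \<open>If the bound failed, each level would exceed the previous one by at least
  \<open>\<eta> * card C / 2\<close>, and after \<open>T \<ge> 2 / \<eta>\<close> rounds a subset of
  \<open>R\<close> would be larger than \<open>R\<close>.\<close>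

lemma missing_colours_bound:
  fixes \<eta> :: real
  assumes finC: "finite C" and HC: "col ` H \<subseteq> C"
    and deg: "\<And>c. c \<in> C \<Longrightarrow> (1 + \<eta>) * card C \<le> card {h \<in> H. col h = c}"
    and opt: "\<And>S. S \<subseteq> H \<Longrightarrow> matching3 S \<Longrightarrow> card S \<le> card R"
    and eta: "\<eta> > 0" and T: "2 \<le> \<eta> * T" and K: "K = 12 * 2 ^ T"
  shows "\<eta> * card (C - col ` R) < 2 * K"
proof (rule ccontr)
  assume "\<not> ?thesis"
  then have many: "2 * K \<le> \<eta> * card (C - col ` R)" by simp
  let ?n = "card C"
  have K0: "K > 0" using K by simp
  have q0: "card (C - col ` R) > 0"
    using many K0 by (intro gr0I) auto
  have RC: "col ` R \<subseteq> C" using RH HC by blast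
  have "card (col ` R) = card R" using matR by (simp add: card_image matching3_def)
  moreover have "card (C - col ` R) = ?n - card (col ` R)"
    using finR RC by (intro card_Diff_subset) auto
  ultimately have Rn: "card R < ?n" using q0 by linarith
  define D where "D = nat \<lceil>(1 + \<eta>) * ?n\<rceil>"
  have D: "(1 + \<eta>) * ?n \<le> D" unfolding D_def by (rule real_nat_ceiling_ge)
  have degD: "D \<le> card {h \<in> H. col h = c}" if "c \<in> C" for c
    using deg[OF that] unfolding D_def by linarith
  have "real t * (\<eta> * ?n / 2) \<le> card (level t)" if "t \<le> T" for t
    using that
  proof (induction t)
    case (Suc t)
    let ?Q = "C - col ` (R - level t)"
    have "12 * 2 ^ t \<le> K" using K Suc.prems by (simp add: power_increasing)
    then have "card ?Q * (D + card (level t)) \<le> card ?Q * (card (level (Suc t)) + card R) + card R * K"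
      using finC HC degD opt by (intro level_growth) auto
    then have "real (card ?Q * (D + card (level t)))
        \<le> real (card ?Q * (card (level (Suc t)) + card R) + card R * K)"
      by (rule of_nat_mono)
    then have g: "real (card ?Q) * (D + card (level t))
        \<le> real (card ?Q) * (card (level (Suc t)) + card R) + real (card R) * K"
      by (simp del: level.simps)
    have Qq: "card (C - col ` R) \<le> card ?Q"
      using finC by (intro card_mono) auto
    have "2 * K \<le> \<eta> * card ?Q"
      by (rule order.trans[OF many]) (use Qq eta in simp)
    \<comment> \<open>With at least \<open>2 * K / \<eta>\<close> available colours, the error
      \<open>card R * K / card ?Q\<close> uses up at most half of the surplus
      \<open>\<eta> * ?n\<close>; the other half is the growth.\<close>
    then have "real (card R) * K \<le> ?n * (\<eta> * card ?Q / 2)"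
      using Rn by (intro mult_mono) auto
    then have "real (card ?Q) * (D + card (level t))
        \<le> real (card ?Q) * (card (level (Suc t)) + card R + ?n * \<eta> / 2)"
      using g by (simp add: algebra_simps del: level.simps)
    then have "real (D + card (level t)) \<le> card (level (Suc t)) + card R + ?n * \<eta> / 2"
      using Qq q0 by (simp del: level.simps)
    then have "card (level t) + \<eta> * ?n / 2 \<le> card (level (Suc t))"
      using D Rn by (simp add: algebra_simps del: level.simps)
    then show ?case using Suc by (simp add: algebra_simps del: level.simps)
  qed simp
  from this[of T] have "real T * (\<eta> * ?n / 2) \<le> card (level T)" by simp
  also have "\<dots> \<le> card R" using finR level_subset by (simp add: card_mono)
  also have "\<dots> < ?n" using Rn by simp
  also have "\<dots> \<le> (\<eta> * T / 2) * ?n" using mult_right_mono[of 1 "\<eta> * T / 2" "real ?n"] T by simp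
  finally show False by (simp add: algebra_simps)
qed

end

section \<open>Random reserves\<close>

text \<open>The method of conditional expectations: the right-hand side is the expectation of the
  left-hand side for a \<open>p\<close>-random subset \<open>S\<close> of \<open>V\<close>.\<close>

lemma subset_below_expectation:
  fixes p :: real and a \<alpha> :: "'j \<Rightarrow> real"
  assumes "finite V" "0 \<le> p" "p \<le> 1"
  shows "\<exists>S \<subseteq> V. (\<Sum>j\<in>J. a j * \<alpha> j ^ card (S \<inter> A j)) \<le> (\<Sum>j\<in>J. a j * (1 - p + p * \<alpha> j) ^ card (V \<inter> A j))"
  using assms(1)
proof (induction V arbitrary: a rule: finite_induct)
  case (insert v V)
  \<comment> \<open>The decision on \<open>v\<close> is taken last: its expected factor is moved
    into the weights, so that the induction hypothesis fixes the choice inside \<open>V\<close>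
    first.\<close>
  define b where "b j = (if v \<in> A j then a j * (1 - p + p * \<alpha> j) else a j)" for j
  let ?\<Phi> = "\<lambda>S. \<Sum>j\<in>J. a j * \<alpha> j ^ card (S \<inter> A j)"
  obtain S where S: "S \<subseteq> V"
    "(\<Sum>j\<in>J. b j * \<alpha> j ^ card (S \<inter> A j)) \<le> (\<Sum>j\<in>J. b j * (1 - p + p * \<alpha> j) ^ card (V \<inter> A j))"
    using insert.IH[of b] by blast
  have vS: "v \<notin> S" and finS: "finite S" using S(1) insert.hyps finite_subset by blast+
  have "(\<Sum>j\<in>J. b j * \<alpha> j ^ card (S \<inter> A j)) = (1 - p) * ?\<Phi> S + p * ?\<Phi> (insert v S)"
    unfolding sum_distrib_left sum.distrib[symmetric]
    by (rule sum.cong) (use vS finS in \<open>auto simp: b_def algebra_simps\<close>)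
  moreover have "(\<Sum>j\<in>J. b j * (1 - p + p * \<alpha> j) ^ card (V \<inter> A j)) =
      (\<Sum>j\<in>J. a j * (1 - p + p * \<alpha> j) ^ card (insert v V \<inter> A j))"
    by (rule sum.cong) (use insert.hyps in \<open>auto simp: b_def\<close>)
  ultimately have avg: "(1 - p) * ?\<Phi> S + p * ?\<Phi> (insert v S) \<le>
      (\<Sum>j\<in>J. a j * (1 - p + p * \<alpha> j) ^ card (insert v V \<inter> A j))" (is "_ \<le> ?E")
    using S(2) by linarith
  have "?\<Phi> S \<le> ?E \<or> ?\<Phi> (insert v S) \<le> ?E"
  proof (rule ccontr)
    assume "\<not> ?thesis"
    then have "?\<Phi> S > ?E" "?\<Phi> (insert v S) > ?E" by auto
    then have "(1 - p) * - ?\<Phi> S + p * - ?\<Phi> (insert v S) < - ?E"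
      using assms by (intro convex_bound_lt) auto
    then show False using avg by simp
  qed
  then show ?case using S(1) by blast
qed simp

text \<open>A derandomised Chernoff bound. Both tails are treated by exponential moments with
  parameters 1 and -1, whose expectations are estimated by e \<le> 3 and 1/e \<le> 1/2. If the
  nonnegative weights sum to less than 1, each is below 1, and this gives all the inequalities at
  once.\<close>

lemma balanced_subset:
  fixes p m1 m2 s t :: real
  assumes V: "finite V" and I: "finite I" and p: "0 \<le> p" "p \<le> 1"
    and A: "\<And>i. i \<in> I \<Longrightarrow> A i \<subseteq> V" "\<And>i. i \<in> I \<Longrightarrow> card (A i) \<le> m1"
    and B: "\<And>i. i \<in> I \<Longrightarrow> B i \<subseteq> V" "\<And>i. i \<in> I \<Longrightarrow> m2 \<le> card (B i)"
    and small: "card I * (exp (2 * p * m1 - t) + exp (s - p * m2 / 2)) < 1"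
  shows "\<exists>S \<subseteq> V. \<forall>i\<in>I. card (S \<inter> A i) < t \<and> s < card (S \<inter> B i)"
proof -
  \<comment> \<open>The boolean index merges the upper tails for \<open>A\<close> and the lower
    tails for \<open>B\<close> into one family.\<close>
  define A' where "A' = (\<lambda>(i, u). if u then A i else B i)"
  define a where "a = (\<lambda>(i::'b, u). if u then exp (- t) else exp s)"
  define \<alpha> :: "'b \<times> bool \<Rightarrow> real" where "\<alpha> = (\<lambda>(i, u). if u then exp 1 else exp (- 1))"
  let ?J = "I \<times> (UNIV :: bool set)"
  obtain S where S: "S \<subseteq> V" "(\<Sum>j\<in>?J. a j * \<alpha> j ^ card (S \<inter> A' j))
      \<le> (\<Sum>j\<in>?J. a j * (1 - p + p * \<alpha> j) ^ card (V \<inter> A' j))"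
    using subset_below_expectation[OF V p] by blast
  have up: "exp (- t) * (1 - p + p * exp 1) ^ card (V \<inter> A i) \<le> exp (2 * p * m1 - t)" if "i \<in> I" for i
  proof -
    have "1 - p + p * exp 1 \<le> 1 + 2 * p"
      using mult_left_mono[OF exp_le p(1)] by simp
    also have "\<dots> \<le> exp (2 * p)" by (rule exp_ge_add_one_self)
    finally have "(1 - p + p * exp 1) ^ card (A i) \<le> exp (2 * p) ^ card (A i)"
      using p by (intro power_mono) (auto intro!: add_nonneg_nonneg)
    also have "\<dots> = exp (card (A i) * (2 * p))" by (simp add: exp_of_nat_mult)
    also have "\<dots> \<le> exp (2 * p * m1)"
      using mult_right_mono[OF A(2)[OF that], of "2 * p"] p by (simp add: mult.commute)
    finally have "exp (- t) * (1 - p + p * exp 1) ^ card (A i) \<le> exp (- t) * exp (2 * p * m1)"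
      by (rule mult_left_mono) simp
    moreover have "V \<inter> A i = A i" using A(1)[OF that] by blast
    ultimately show ?thesis by (simp add: exp_add[symmetric])
  qed
  have lo: "exp s * (1 - p + p * exp (- 1)) ^ card (V \<inter> B i) \<le> exp (s - p * m2 / 2)" if "i \<in> I" for i
  proof -
    have "exp (- 1 :: real) \<le> 1 / 2"
      using exp_ge_add_one_self[of "1::real"] by (simp add: exp_minus field_simps)
    then have "1 - p + p * exp (- 1) \<le> 1 + (- p / 2)"
      using mult_left_mono[of "exp (- 1)" "1 / 2" p] p by simp
    also have "\<dots> \<le> exp (- p / 2)" by (rule exp_ge_add_one_self)
    finally have "(1 - p + p * exp (- 1)) ^ card (B i) \<le> exp (- p / 2) ^ card (B i)"
      using p by (intro power_mono) (auto intro!: add_nonneg_nonneg)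
    also have "\<dots> = exp (card (B i) * (- p / 2))" by (rule exp_of_nat_mult[symmetric])
    also have "\<dots> \<le> exp (- (p * m2 / 2))"
      using mult_right_mono[OF B(2)[OF that], of "p / 2"] p by (simp add: mult.commute)
    finally have "exp s * (1 - p + p * exp (- 1)) ^ card (B i) \<le> exp s * exp (- (p * m2 / 2))"
      by (rule mult_left_mono) simp
    moreover have "V \<inter> B i = B i" using B(1)[OF that] by blast
    ultimately show ?thesis by (simp add: exp_add[symmetric])
  qed
  have "(\<Sum>j\<in>?J. a j * (1 - p + p * \<alpha> j) ^ card (V \<inter> A' j)) =
      (\<Sum>i\<in>I. exp (- t) * (1 - p + p * exp 1) ^ card (V \<inter> A i) +
        exp s * (1 - p + p * exp (- 1)) ^ card (V \<inter> B i))"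
    by (simp add: sum.cartesian_product' UNIV_bool a_def \<alpha>_def A'_def add.commute)
  also have "\<dots> \<le> (\<Sum>i\<in>I. exp (2 * p * m1 - t) + exp (s - p * m2 / 2))"
    by (intro sum_mono add_mono up lo)
  also have "\<dots> < 1" using small by simp
  finally have less1: "(\<Sum>j\<in>?J. a j * \<alpha> j ^ card (S \<inter> A' j)) < 1" using S(2) by linarith
  have weight: "a j * \<alpha> j ^ card (S \<inter> A' j) < 1" if "j \<in> ?J" for j
  proof -
    have "a j * \<alpha> j ^ card (S \<inter> A' j) \<le> (\<Sum>j\<in>?J. a j * \<alpha> j ^ card (S \<inter> A' j))"
      by (rule member_le_sum[OF that]) (use I in \<open>auto simp: a_def \<alpha>_def\<close>)
    then show ?thesis using less1 by linarith
  qed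
  have "card (S \<inter> A i) < t \<and> s < card (S \<inter> B i)" if "i \<in> I" for i
  proof -
    have "exp (- t) * exp (card (S \<inter> A i)) < 1"
      using weight[of "(i, True)"] that by (simp add: a_def \<alpha>_def A'_def exp_of_nat_mult[symmetric])
    then have "exp (card (S \<inter> A i) - t) < 1" by (simp add: exp_diff exp_minus field_simps)
    moreover have "exp s * exp (- real (card (S \<inter> B i))) < 1"
      using weight[of "(i, False)"] that by (simp add: a_def \<alpha>_def A'_def exp_of_nat_mult[symmetric])
    then have "exp (s - card (S \<inter> B i)) < 1" by (simp add: exp_diff exp_minus field_simps)
    ultimately show ?thesis by simp
  qed
  then show ?thesis using S(1) by blast
qed

section \<open>Rainbow matchings\<close>

text \<open>This compares the stated threshold with what the argument for \<epsilon> < 1 needs. For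
  \<epsilon> \<le> 1/2 the base 2 is at most 1/\<epsilon>; for larger \<epsilon> the exponent
  4/\<epsilon> is below 8, whence the factor 256. The exponents 4 and 12 add up to 16.\<close>

lemma threshold_lower_bound:
  fixes \<epsilon> :: real
  assumes "0 < \<epsilon>" "\<epsilon> < 1"
  shows "10 ^ 17 * 2 powr (4 / \<epsilon>) / \<epsilon> ^ 4 \<le> 10 ^ 20 * \<epsilon> powr (- 16 / \<epsilon>)"
proof -
  have two: "2 powr (4 / \<epsilon>) \<le> 256 * \<epsilon> powr (- 4 / \<epsilon>)"
  proof (cases "\<epsilon> \<le> 1 / 2")
    case True
    have "2 powr (4 / \<epsilon>) \<le> (1 / \<epsilon>) powr (4 / \<epsilon>)"
      using assms True by (intro powr_mono2) (auto simp: field_simps)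
    also have "\<dots> = \<epsilon> powr (- 4 / \<epsilon>)"
      using assms by (simp add: powr_divide powr_minus_divide)
    also have "\<dots> \<le> 256 * \<epsilon> powr (- 4 / \<epsilon>)" by simp
    finally show ?thesis .
  next
    case False
    have "2 powr (4 / \<epsilon>) \<le> 2 powr (8 :: real)"
      using assms False by (intro powr_mono) (auto simp: field_simps)
    also have "\<dots> = 256 * 1" by simp
    also have "1 = \<epsilon> powr 0" using assms by simp
    also have "\<epsilon> powr 0 \<le> \<epsilon> powr (- 4 / \<epsilon>)"
      using assms by (intro powr_mono') auto
    finally show ?thesis by simp
  qed
  have four: "1 / \<epsilon> ^ 4 \<le> \<epsilon> powr (- 12 / \<epsilon>)"
  proof -
    have "1 / \<epsilon> ^ 4 = \<epsilon> powr (- 4)"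
      using assms by (simp add: powr_minus_divide powr_numeral)
    also have "\<dots> \<le> \<epsilon> powr (- 12 / \<epsilon>)"
      using assms by (intro powr_mono') (auto simp: field_simps)
    finally show ?thesis .
  qed
  have "10 ^ 17 * 2 powr (4 / \<epsilon>) / \<epsilon> ^ 4 = 10 ^ 17 * (2 powr (4 / \<epsilon>) * (1 / \<epsilon> ^ 4))"
    by simp
  also have "\<dots> \<le> 10 ^ 17 * ((256 * \<epsilon> powr (- 4 / \<epsilon>)) * \<epsilon> powr (- 12 / \<epsilon>))"
    using assms by (intro mult_left_mono mult_mono two four) auto
  also have "\<dots> = 10 ^ 17 * 256 * \<epsilon> powr (- 16 / \<epsilon>)"
    using assms by (simp add: powr_add[symmetric] field_simps)
  also have "\<dots> \<le> 10 ^ 20 * \<epsilon> powr (- 16 / \<epsilon>)"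
    by (intro mult_right_mono) auto
  finally show ?thesis .
qed

text \<open>\<open>Y\<close> is chosen first, then \<open>X\<close>, which is balanced also against
  the left ends of the triples already ending in \<open>Y\<close>. Choosing in succession makes each
  lower tail a statement about a single random set.\<close>

lemma exists_reserve:
  fixes \<epsilon> :: real
  assumes finC: "finite C" and finH: "finite H" and lin: "linear3 H"
    and deg: "\<And>c. c \<in> C \<Longrightarrow> card {h \<in> H. col h = c} = m"
    and m: "card C \<le> m" "m \<le> 2 * card C" and eps: "0 < \<epsilon>" "\<epsilon> < 1"
    and n: "10 ^ 17 \<le> \<epsilon> ^ 4 * card C"
  obtains X Y where
    "\<And>c. c \<in> C \<Longrightarrow> card {h \<in> H. col h = c \<and> lft h \<in> X} < \<epsilon> * card C / 4"
    "\<And>c. c \<in> C \<Longrightarrow> card {h \<in> H. col h = c \<and> rgt h \<in> Y} < \<epsilon> * card C / 4"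
    "\<And>c. c \<in> C \<Longrightarrow> \<epsilon> ^ 2 * card C / 16384 < card {h \<in> H. col h = c \<and> lft h \<in> X \<and> rgt h \<in> Y}"
proof -
  define n where "n = real (card C)"
  \<comment> \<open>With this density \<open>2 * p * m\<close> is at most \<epsilon> n / 8, half of
    the permitted loss \<open>t\<close>.\<close>
  define p where "p = \<epsilon> / 32"
  define t where "t = \<epsilon> * n / 4"
  have n0: "n > 0"
    using n by (cases "card C = 0") (auto simp: n_def)
  have mn: "n \<le> m" "m \<le> 2 * n" using m unfolding n_def by linarith+
  have p: "0 < p" "p \<le> 1" using eps by (auto simp: p_def)
  have ee: "\<epsilon> ^ 2 \<le> \<epsilon>" using eps by (simp add: power2_eq_square mult_le_cancel_left1)
  let ?F = "\<lambda>c. {h \<in> H. col h = c}"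
  have injF: "inj_on lft A" "inj_on rgt A" if "A \<subseteq> ?F c" for A c
    by (rule linear3_inj_on_col[OF lin, where c = c]; use that in auto)+
  \<comment> \<open>Here \<open>z = p\<^sup>2 * n / 16\<close>, and all tail exponents below are at
    most \<open>- z\<close>. As \<open>z\<close> is linear in \<open>n\<close>, the quadratic Taylor
    bound for \<open>exp\<close> outweighs the \<open>2 * n\<close> tail events.\<close>
  define z where "z = \<epsilon> ^ 2 * n / 16384"
  have z: "n * (exp (- z) + exp (- z)) < 1"
  proof -
    have z0: "z > 0" using eps n0 by (simp add: z_def)
    have "4 * n < 10 ^ 17 * (n / 16384 ^ 2)" using n0 by simp
    also have "\<dots> \<le> \<epsilon> ^ 4 * n * (n / 16384 ^ 2)"
      using n n0 by (intro mult_right_mono) (auto simp: n_def)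
    also have "\<dots> = z\<^sup>2"
      by (simp add: z_def power2_eq_square power4_eq_xxxx)
    finally have "4 * n < z\<^sup>2" .
    then have "2 * n < 1 + z + z\<^sup>2 / 2" using z0 by simp
    also have "\<dots> \<le> exp z" using z0 by (intro exp_lower_Taylor_quadratic) simp
    finally show ?thesis by (simp add: exp_minus field_simps)
  qed
  have tail: "2 * p * m - t \<le> - z"
  proof -
    have "2 * p * m - t \<le> 2 * p * (2 * n) - t"
      using mn p by (intro diff_right_mono mult_left_mono) auto
    also have "\<dots> = - (\<epsilon> * n / 8)" by (simp add: p_def t_def)
    also have "\<dots> \<le> - z"
      using mult_right_mono[OF ee, of n] n0 eps by (simp add: z_def)
    finally show ?thesis .
  qed
  have pm: "z \<le> p\<^sup>2 * m / 16" "p\<^sup>2 * m / 16 \<le> p * m / 4"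
  proof -
    have "z = p\<^sup>2 * n / 16" by (simp add: z_def p_def power2_eq_square)
    then show "z \<le> p\<^sup>2 * m / 16"
      using mult_left_mono[OF mn(1), of "p\<^sup>2"] by simp
    have "p\<^sup>2 * m \<le> p * m"
      using p by (intro mult_right_mono) (auto simp: power2_eq_square mult_le_cancel_left1)
    then show "p\<^sup>2 * m / 16 \<le> p * m / 4"
      using mult_nonneg_nonneg[of p "real m"] p by linarith
  qed
  have pm': "p * m / 4 - p * m / 2 \<le> - z" using pm by linarith
  have cards: "card (lft ` ?F c) = m" "card (rgt ` ?F c) = m" if "c \<in> C" for c
    using injF[OF order.refl] deg[OF that] by (simp_all add: card_image)
  have "\<exists>Y \<subseteq> rgt ` H. \<forall>c\<in>C. card (Y \<inter> rgt ` ?F c) < t \<and> p * m / 4 < card (Y \<inter> rgt ` ?F c)"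
  proof (rule balanced_subset[where p = p and ?m1.0 = m and ?m2.0 = m])
    have "n * (exp (2 * p * m - t) + exp (p * m / 4 - p * m / 2)) \<le> n * (exp (- z) + exp (- z))"
      using n0 by (intro mult_left_mono add_mono exp_le_cancel_iff[THEN iffD2] tail pm') simp
    then show "card C * (exp (2 * p * m - t) + exp (p * m / 4 - p * m / 2)) < 1"
      using z by (simp add: n_def)
  qed (use finC finH p cards in auto)
  then obtain Y where Y: "\<And>c. c \<in> C \<Longrightarrow> card (Y \<inter> rgt ` ?F c) < t"
    "\<And>c. c \<in> C \<Longrightarrow> p * m / 4 < card (Y \<inter> rgt ` ?F c)" by blast
  let ?G = "\<lambda>c. {h \<in> H. col h = c \<and> rgt h \<in> Y}"
  have "Y \<inter> rgt ` ?F c = rgt ` ?G c" for c by auto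
  then have cY: "card (Y \<inter> rgt ` ?F c) = card (?G c)" for c
    using injF(2)[of "?G c" c] by (simp add: card_image Collect_mono)
  have cG: "card (lft ` ?G c) = card (?G c)" for c
    by (rule card_image, rule injF[of _ c]) auto
  have "\<exists>X \<subseteq> lft ` H. \<forall>c\<in>C. card (X \<inter> lft ` ?F c) < t \<and> p\<^sup>2 * m / 16 < card (X \<inter> lft ` ?G c)"
  proof (rule balanced_subset[where p = p and ?m1.0 = m and ?m2.0 = "p * m / 4"])
    have "p\<^sup>2 * m / 16 - p * (p * m / 4) / 2 = - (p\<^sup>2 * m / 16)"
      by (simp add: power2_eq_square)
    then have "n * (exp (2 * p * m - t) + exp (p\<^sup>2 * m / 16 - p * (p * m / 4) / 2))
        \<le> n * (exp (- z) + exp (- z))"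
      using n0 tail pm by (intro mult_left_mono add_mono) auto
    then show "card C * (exp (2 * p * m - t) + exp (p\<^sup>2 * m / 16 - p * (p * m / 4) / 2)) < 1"
      using z by (simp add: n_def)
    show "p * m / 4 \<le> card (lft ` ?G c)" if "c \<in> C" for c
      using Y(2)[OF that] cY[of c] cG[of c] by simp
  qed (use finC finH p cards in auto)
  then obtain X where X: "\<And>c. c \<in> C \<Longrightarrow> card (X \<inter> lft ` ?F c) < t"
    "\<And>c. c \<in> C \<Longrightarrow> p\<^sup>2 * m / 16 < card (X \<inter> lft ` ?G c)" by blast
  have "X \<inter> lft ` ?F c = lft ` {h \<in> H. col h = c \<and> lft h \<in> X}"
    "X \<inter> lft ` ?G c = lft ` {h \<in> H. col h = c \<and> lft h \<in> X \<and> rgt h \<in> Y}" for c by auto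
  moreover have "card (lft ` {h \<in> H. col h = c \<and> lft h \<in> X}) = card {h \<in> H. col h = c \<and> lft h \<in> X}"
    "card (lft ` {h \<in> H. col h = c \<and> lft h \<in> X \<and> rgt h \<in> Y})
      = card {h \<in> H. col h = c \<and> lft h \<in> X \<and> rgt h \<in> Y}" for c
    by (rule card_image, rule injF[of _ c], blast)+
  ultimately have cX: "card (X \<inter> lft ` ?F c) = card {h \<in> H. col h = c \<and> lft h \<in> X}"
    "card (X \<inter> lft ` ?G c) = card {h \<in> H. col h = c \<and> lft h \<in> X \<and> rgt h \<in> Y}" for c
    by (simp_all only:)
  show ?thesis
  proof (rule that[of X Y])
    fix c assume c: "c \<in> C"
    show "card {h \<in> H. col h = c \<and> lft h \<in> X} < \<epsilon> * card C / 4"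
      using X(1)[OF c] by (simp only: cX t_def n_def)
    show "card {h \<in> H. col h = c \<and> rgt h \<in> Y} < \<epsilon> * card C / 4"
      using Y(1)[OF c] by (simp only: cY t_def n_def)
    show "\<epsilon> ^ 2 * card C / 16384 < card {h \<in> H. col h = c \<and> lft h \<in> X \<and> rgt h \<in> Y}"
      using le_less_trans[OF pm(1) X(2)[OF c]] by (simp only: cX z_def n_def)
  qed
qed

theorem perfect_matching3:
  fixes \<epsilon> :: real
  assumes finC: "finite C" and finH: "finite H" and lin: "linear3 H" and HC: "col ` H \<subseteq> C"
    and deg: "\<And>c. c \<in> C \<Longrightarrow> card {h \<in> H. col h = c} = m"
    and m: "(1 + \<epsilon>) * card C \<le> m" "m \<le> 2 * card C" and eps: "0 < \<epsilon>" "\<epsilon> < 1"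
    and n: "10 ^ 17 * 2 powr (4 / \<epsilon>) / \<epsilon> ^ 4 \<le> card C"
  shows "\<exists>S \<subseteq> H. matching3 S \<and> col ` S = C"
proof -
  define n where "n = real (card C)"
  have e4: "10 ^ 17 * 2 powr (4 / \<epsilon>) \<le> \<epsilon> ^ 4 * n"
    using n eps by (simp add: n_def field_simps)
  have one: "(1::real) \<le> 2 powr (4 / \<epsilon>)" using eps by (intro ge_one_powr_ge_zero) auto
  then have "10 ^ 17 * 1 \<le> 10 ^ 17 * 2 powr (4 / \<epsilon>)" by (rule mult_left_mono) simp
  then have e4': "10 ^ 17 \<le> \<epsilon> ^ 4 * n" using e4 by simp
  have "1 * n \<le> (1 + \<epsilon>) * n" using eps by (intro mult_right_mono) (auto simp: n_def)
  then have Cm: "card C \<le> m" using m(1) unfolding n_def by linarith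
  obtain X Y where XY: "\<And>c. c \<in> C \<Longrightarrow> card {h \<in> H. col h = c \<and> lft h \<in> X} < \<epsilon> * n / 4"
    "\<And>c. c \<in> C \<Longrightarrow> card {h \<in> H. col h = c \<and> rgt h \<in> Y} < \<epsilon> * n / 4"
    "\<And>c. c \<in> C \<Longrightarrow> \<epsilon> ^ 2 * n / 16384 < card {h \<in> H. col h = c \<and> lft h \<in> X \<and> rgt h \<in> Y}"
    using exists_reserve[OF finC finH lin deg Cm m(2) eps e4'[unfolded n_def]] unfolding n_def by blast
  define G where "G = {h \<in> H. lft h \<notin> X \<and> rgt h \<notin> Y}"
  define G' where "G' = {h \<in> H. lft h \<in> X \<and> rgt h \<in> Y}"
  have GH: "G \<subseteq> H" "G' \<subseteq> H" by (auto simp: G_def G'_def)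
  have linG: "linear3 G" "linear3 G'" using linear3_subset[OF lin] GH by blast+
  have finG: "finite G" "finite G'" using GH finH finite_subset by blast+
  \<comment> \<open>Each of the two reserved sets takes less than \<epsilon> n / 4 triples of a
    colour, so half of the surplus survives.\<close>
  have degG: "(1 + \<epsilon> / 2) * card C \<le> card {h \<in> G. col h = c}" if c: "c \<in> C" for c
  proof -
    have "{h \<in> H. col h = c} \<subseteq> {h \<in> G. col h = c} \<union> {h \<in> H. col h = c \<and> lft h \<in> X}
        \<union> {h \<in> H. col h = c \<and> rgt h \<in> Y}" by (auto simp: G_def)
    then have "m \<le> card ({h \<in> G. col h = c} \<union> {h \<in> H. col h = c \<and> lft h \<in> X}
        \<union> {h \<in> H. col h = c \<and> rgt h \<in> Y})"
      unfolding deg[OF c, symmetric] using finH finG by (intro card_mono) auto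
    also have "\<dots> \<le> card {h \<in> G. col h = c} + card {h \<in> H. col h = c \<and> lft h \<in> X}
        + card {h \<in> H. col h = c \<and> rgt h \<in> Y}"
      by (intro order.trans[OF card_Un_le] add_right_mono card_Un_le)
    finally have "real m \<le> card {h \<in> G. col h = c} + card {h \<in> H. col h = c \<and> lft h \<in> X}
        + card {h \<in> H. col h = c \<and> rgt h \<in> Y}" by linarith
    then show ?thesis using m(1) XY(1,2)[OF c] by (simp add: n_def algebra_simps)
  qed
  let ?P = "\<lambda>R. R \<subseteq> G \<and> matching3 R"
  have "?P {}" by (simp add: matching3_def)
  moreover have "\<forall>R. ?P R \<longrightarrow> card R < Suc (card G)"
    using finG by (simp add: card_mono less_Suc_eq_le)
  ultimately obtain R where R: "R \<subseteq> G" "matching3 R"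
    and opt: "\<And>S. S \<subseteq> G \<Longrightarrow> matching3 S \<Longrightarrow> card S \<le> card R"
    using ex_has_greatest_nat[of ?P "{}" card "Suc (card G)"] by auto
  \<comment> \<open>For the remaining surplus \<epsilon> / 2 the switching argument needs at least 4
    / \<epsilon> rounds; rounding up costs at most a factor 2 in \<open>2 ^ T\<close>.\<close>
  define T where "T = nat \<lceil>4 / \<epsilon>\<rceil>"
  have "0 \<le> 4 / \<epsilon>" using eps by simp
  then have T: "4 / \<epsilon> \<le> T" "T \<le> 4 / \<epsilon> + 1" unfolding T_def by linarith+
  define K :: nat where "K = 12 * 2 ^ T"
  define L where "L = C - col ` R"
  interpret switching G R K
    by unfold_locales (use finG R linG in auto)
  have "\<epsilon> / 2 * card (C - col ` R) < 2 * K"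
  proof (rule missing_colours_bound[where T = T])
    show "2 \<le> \<epsilon> / 2 * T" using T(1) eps by (simp add: field_simps)
  qed (use finC HC GH degG opt eps K_def in auto)
  then have "\<epsilon> * card L < 48 * 2 ^ T" by (simp add: K_def L_def)
  also have "(2::real) ^ T = 2 powr T" by (simp add: powr_realpow)
  also have "\<dots> \<le> 2 powr (4 / \<epsilon> + 1)" using T(2) by (intro powr_mono) auto
  finally have "\<epsilon> * card L < 96 * 2 powr (4 / \<epsilon>)" by (simp add: powr_add)
  \<comment> \<open>The target is 32768 = 2 * 16384 because the greedy completion needs twice as
    many reserved triples per colour as there are missing colours.\<close>
  also have "\<dots> \<le> \<epsilon> ^ 4 * n / 32768"
    using e4 one by simp
  also have "\<dots> \<le> \<epsilon> ^ 3 * n / 32768"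
    using eps by (intro divide_right_mono mult_right_mono power_decreasing) (auto simp: n_def)
  also have "\<dots> = \<epsilon> * (\<epsilon> ^ 2 * n / 32768)" by (simp add: power3_eq_cube power2_eq_square)
  finally have L: "2 * card L < \<epsilon> ^ 2 * n / 16384"
    using eps by (simp add: mult_less_cancel_left_pos)
  have "\<exists>S \<subseteq> G'. matching3 S \<and> col ` S = L"
  proof (rule greedy_matching3)
    show "2 * card L \<le> card {h \<in> G'. col h = c}" if "c \<in> L" for c
    proof -
      have "{h \<in> G'. col h = c} = {h \<in> H. col h = c \<and> lft h \<in> X \<and> rgt h \<in> Y}"
        by (auto simp: G'_def)
      then show ?thesis using L XY(3)[of c] that by (simp add: L_def)
    qed
  qed (use finC finG linG in \<open>auto simp: L_def\<close>)
  then obtain S where S: "S \<subseteq> G'" "matching3 S" "col ` S = L" by blast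
  have "lft ` R \<inter> X = {}" "rgt ` R \<inter> Y = {}" using R(1) by (auto simp: G_def)
  moreover have "lft ` S \<subseteq> X" "rgt ` S \<subseteq> Y" using S(1) by (auto simp: G'_def)
  ultimately have "lft ` R \<inter> lft ` S = {}" "rgt ` R \<inter> rgt ` S = {}" by (meson disjoint_iff subsetD)+
  then have "matching3 (R \<union> S)"
    by (intro matching3_union R(2) S(2)) (use S(3) in \<open>auto simp: L_def\<close>)
  moreover have "col ` (R \<union> S) = C"
    unfolding image_Un S(3) L_def using HC R(1) GH(1) by blast
  ultimately show ?thesis using R(1) S(1) GH by (intro exI[of _ "R \<union> S"]) auto
qed

theorem mainTheorem1:
  fixes \<epsilon> :: real and n :: nat and M :: "nat \<Rightarrow> 'a set set"
  assumes eps: "\<epsilon> > 0"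
    and nN: "real n \<ge> 10^20 * \<epsilon> powr (- 16 / \<epsilon>)"
    and bip: "bipartite (\<Union>i<n. M i)"
    and match: "\<forall>i<n. matching (M i)"
    and disj: "\<forall>i<n. \<forall>j<n. i \<noteq> j \<longrightarrow> M i \<inter> M j = {}"
    and big: "\<forall>i<n. finite (M i) \<and> real (card (M i)) \<ge> (1 + \<epsilon>) * real n"
  shows "\<exists>R. rainbow_matching M n R \<and> finite R \<and> card R = n"
proof -
  obtain X where X: "\<And>i e. i < n \<Longrightarrow> e \<in> M i \<Longrightarrow> is_edge e \<and> card (e \<inter> X) = 1"
    using bip unfolding bipartite_def by blast
  \<comment> \<open>Every class is cut down to exactly \<open>m\<close> edges, since the reserve is
    built for classes of equal size, at most twice the number of colours.\<close>
  define m where "m = nat \<lceil>(1 + \<epsilon>) * n\<rceil>"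
  have m: "(1 + \<epsilon>) * n \<le> m" unfolding m_def by (rule real_nat_ceiling_ge)
  have "\<exists>A. A \<subseteq> M i \<and> card A = m" if "i < n" for i
  proof -
    have "m \<le> card (M i)" using big that unfolding m_def by (simp add: nat_le_iff ceiling_le_iff)
    then show ?thesis by (meson obtain_subset_with_card_n)
  qed
  then obtain M' where M': "\<And>i. i < n \<Longrightarrow> M' i \<subseteq> M i" "\<And>i. i < n \<Longrightarrow> card (M' i) = m"
    by metis
  have meet: "e = f" if "i < n" "e \<in> M i" "f \<in> M i" "v \<in> e" "v \<in> f" for i e f v
    using match that unfolding matching_def by blast
  define H where "H = {(i, x, y). i < n \<and> {x, y} \<in> M' i \<and> x \<in> X \<and> y \<notin> X}"
  let ?E = "\<lambda>h :: nat \<times> 'a \<times> 'a. {lft h, rgt h}"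
  have H: "col h < n" "?E h \<in> M (col h)" "lft h \<in> X" "rgt h \<notin> X" if "h \<in> H" for h
    using that by (auto simp: H_def dest: subsetD[OF M'(1)])
  have fibre: "bij_betw ?E {h \<in> H. col h = i} (M' i)" if i: "i < n" for i
  proof (rule bij_betw_imageI)
    show "inj_on ?E {h \<in> H. col h = i}"
      by (rule inj_onI) (auto simp: H_def doubleton_eq_iff)
    show "?E ` {h \<in> H. col h = i} = M' i"
    proof
      show "?E ` {h \<in> H. col h = i} \<subseteq> M' i" by (auto simp: H_def)
      show "M' i \<subseteq> ?E ` {h \<in> H. col h = i}"
      proof
        fix e assume e: "e \<in> M' i"
        then have c: "card e = 2" "card (e \<inter> X) = 1" using X M'(1) i by (auto simp: is_edge_def)
        then obtain x where x: "e \<inter> X = {x}" by (meson card_1_singletonE)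
        obtain u v where uv: "e = {u, v}" "u \<noteq> v" using c(1) by (meson card_2_iff)
        define y where "y = (if x = u then v else u)"
        have "e = {x, y}" "y \<notin> X" using x uv by (auto simp: y_def split: if_splits)
        then have "(i, x, y) \<in> {h \<in> H. col h = i}" using x i e by (auto simp: H_def)
        then show "e \<in> ?E ` {h \<in> H. col h = i}" using \<open>e = {x, y}\<close> by force
      qed
    qed
  qed
  have deg: "card {h \<in> H. col h = i} = m" if "i \<in> {..<n}" for i
    using bij_betw_same_card[OF fibre] M'(2) that by simp
  have "finite {h \<in> H. col h = i}" if "i < n" for i
  proof -
    have "finite (M' i)" using M'(1) big that by (meson finite_subset)
    then show ?thesis using bij_betw_finite[OF fibre[OF that]] by simp
  qed
  then have "finite (\<Union>i<n. {h \<in> H. col h = i})" by simp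
  moreover have "H = (\<Union>i<n. {h \<in> H. col h = i})" using H(1) by blast
  ultimately have finH: "finite H" by simp
  have lin: "linear3 H"
    unfolding linear3_def
  proof (intro ballI impI)
    fix g h assume gh: "g \<in> H" "h \<in> H" and
      or3: "col g = col h \<and> lft g = lft h \<or> col g = col h \<and> rgt g = rgt h \<or> lft g = lft h \<and> rgt g = rgt h"
    \<comment> \<open>Colours agree by assumption or by disjointness of the classes; after that, two
      edges of one matching share a vertex and must coincide.\<close>
    have "col g = col h"
    proof (cases "lft g = lft h \<and> rgt g = rgt h")
      case True
      then have "?E g \<in> M (col g) \<inter> M (col h)" using H(2)[OF gh(1)] H(2)[OF gh(2)] by simp
      then show ?thesis using disj H(1)[OF gh(1)] H(1)[OF gh(2)] by blast
    qed (use or3 in blast)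
    moreover have "?E g = ?E h"
      by (rule meet[of "col g" _ _ "if lft g = lft h then lft g else rgt g"])
        (use or3 H(1,2)[OF gh(1)] H(2)[OF gh(2)] calculation in auto)
    then have "lft g = lft h \<and> rgt g = rgt h"
      using H(3,4)[OF gh(1)] H(3,4)[OF gh(2)] by (auto simp: doubleton_eq_iff)
    ultimately show "g = h" by (simp add: prod_eq_iff)
  qed
  have HC: "col ` H \<subseteq> {..<n}" using H(1) by auto
  have "\<exists>S \<subseteq> H. matching3 S \<and> col ` S = {..<n}"
  proof (cases "\<epsilon> < 1")
    case True
    have "(1 + \<epsilon>) * n \<le> 2 * real n" using True by (intro mult_right_mono) auto
    then have "m \<le> 2 * n" unfolding m_def by (simp add: nat_le_iff ceiling_le_iff)
    moreover have "10 ^ 17 * 2 powr (4 / \<epsilon>) / \<epsilon> ^ 4 \<le> n"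
      using threshold_lower_bound[OF eps True] nN by linarith
    ultimately show ?thesis
      using perfect_matching3[OF _ finH lin HC deg _ _ eps True] m by simp
  next
    case False
    then have "2 * real n \<le> (1 + \<epsilon>) * n" by (intro mult_right_mono) auto
    then have "2 * n \<le> m" using m by linarith
    then show ?thesis
      by (intro greedy_matching3[where N = n] finH lin) (use deg in auto)
  qed
  then obtain S where S: "S \<subseteq> H" "matching3 S" "col ` S = {..<n}" by blast
  have sep: "?E g \<inter> ?E h = {}" if "g \<in> S" "h \<in> S" "g \<noteq> h" for g h
  proof -
    have "lft g \<noteq> lft h" "rgt g \<noteq> rgt h"
      using that S(2) unfolding matching3_def inj_on_def by blast+
    moreover have "lft g \<in> X" "rgt g \<notin> X" "lft h \<in> X" "rgt h \<notin> X"
      using H(3,4) that(1,2) S(1) by blast+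
    ultimately show ?thesis by auto
  qed
  have injE: "inj_on ?E S"
    using sep by (intro inj_onI) blast
  have finS: "finite S" using S(1) finH finite_subset by blast
  have "card S = n"
    using S(2,3) card_image[of col S] by (simp add: matching3_def)
  then have "card (?E ` S) = n" using injE by (simp add: card_image)
  moreover have "rainbow_matching M n (?E ` S)"
    unfolding rainbow_matching_def
  proof (intro conjI allI impI)
    show "?E ` S \<subseteq> (\<Union>i<n. M i)" using H(1,2) S(1) by blast
    show "matching (?E ` S)"
      unfolding matching_def
    proof (intro conjI ballI impI)
      show "is_edge e" if "e \<in> ?E ` S" for e
        using that H(1,2) S(1) X by blast
      show "e \<inter> f = {}" if "e \<in> ?E ` S" "f \<in> ?E ` S" "e \<noteq> f" for e f
        using that sep by blast
    qed
    show "card (?E ` S \<inter> M i) \<le> 1" if i: "i < n" for i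
    proof -
      \<comment> \<open>By disjointness of the classes an edge lying in \<open>M i\<close> can only
        come from a triple of colour \<open>i\<close>, and \<open>S\<close> contains at most one
        such triple.\<close>
      have "col h = i" if "h \<in> S" "?E h \<in> M i" for h
        using that H(1,2)[of h] S(1) disj i by blast
      then have "?E ` S \<inter> M i \<subseteq> ?E ` {h \<in> S. col h = i}" by blast
      then have "card (?E ` S \<inter> M i) \<le> card (?E ` {h \<in> S. col h = i})"
        using finS by (intro card_mono) auto
      also have "\<dots> \<le> card {h \<in> S. col h = i}" using finS by (intro card_image_le) auto
      also have "\<dots> \<le> 1"
        using S(2) finS unfolding matching3_def inj_on_def
        by (subst One_nat_def, subst card_le_Suc0_iff_eq) auto
      finally show ?thesis .
    qed
  qed
  ultimately show ?thesis using finS by (intro exI[of _ "?E ` S"]) auto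
qed

end
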